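(* Let $G$ be a harmonic graph with $n$ vertices and $m\ge 1$ edges, i.e. there is a real number $\lambda$ such that $\lambda d_i=\sum_{j\sim i} d_j$ for every vertex $i$, where $d_i$ denotes the degree of vertex $i$ and $j\sim i$ means $j$ is adjacent to $i$. Let $\rho$ be the spectral radius of the adjacency matrix of $G$, let $\epsilon(G)=\rho-\frac{2m}{n}$, let $\operatorname{var}(G)=\frac{1}{n}\sum_{u\in V(G)}\left(d_u-\frac{2m}{n}\right)^2$, and let $Z_G=\sum_{u\in V(G)} d_u^2$. Then $$\epsilon(G)\le\sqrt{\operatorname{var}(G)}\cdot\sqrt{\frac{nZ_G}{4m^2}-1}.$$ *)

theory Defs
  imports Complex_Main "Jordan_Normal_Form.Spectral_Radius"
begin

(* An edge is the unordered pair {u, v} of its endpoints.  Cardinality 2 excludes loops, and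
   finiteness of E follows from that of V. *)
definition simple_graph :: "'a set \<Rightarrow> 'a set set \<Rightarrow> bool" where
  "simple_graph V E \<longleftrightarrow> finite V \<and> (\<forall>e\<in>E. e \<subseteq> V \<and> card e = 2)"

definition adjacent :: "'a set set \<Rightarrow> 'a \<Rightarrow> 'a \<Rightarrow> bool" where
  "adjacent E u v \<longleftrightarrow> {u, v} \<in> E"

definition deg :: "'a set \<Rightarrow> 'a set set \<Rightarrow> 'a \<Rightarrow> nat" where
  "deg V E u = card {v \<in> V. adjacent E u v}"

definition harmonic_graph :: "'a set \<Rightarrow> 'a set set \<Rightarrow> bool" where
  "harmonic_graph V E \<longleftrightarrow>
     (\<exists>l::real. \<forall>u\<in>V. l * real (deg V E u) = (\<Sum>v | v \<in> V \<and> adjacent E u v. real (deg V E v)))"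

(* Matrices are indexed by {0..<n}, so the vertices are listed as vs.  The entries are complex
   because spectral_radius is defined for complex matrices. *)
definition adjacency_matrix :: "'a list \<Rightarrow> 'a set set \<Rightarrow> complex mat" where
  "adjacency_matrix vs E =
     mat (length vs) (length vs) (\<lambda>(i, j). if adjacent E (vs ! i) (vs ! j) then 1 else 0)"

definition mean_degree :: "'a set \<Rightarrow> 'a set set \<Rightarrow> real" where
  "mean_degree V E = 2 * real (card E) / real (card V)"

definition graph_epsilon :: "'a list \<Rightarrow> 'a set set \<Rightarrow> real" where
  "graph_epsilon vs E = spectral_radius (adjacency_matrix vs E) - mean_degree (set vs) E"

definition graph_var :: "'a set \<Rightarrow> 'a set set \<Rightarrow> real" where
  "graph_var V E = (1 / real (card V)) * (\<Sum>u\<in>V. (real (deg V E u) - mean_degree V E)\<^sup>2)"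

definition graph_Z :: "'a set \<Rightarrow> 'a set set \<Rightarrow> real" where
  "graph_Z V E = (\<Sum>u\<in>V. (real (deg V E u))\<^sup>2)"

end

(* Double counting gives 2m = sum d_u, and summing the harmonic condition over all vertices then
   gives lambda = Z / (2m).  The degree vector is a nonnegative eigenvector for lambda, so testing
   any other eigenvector x against it, i.e. bounding the sum of d_u |x_u|, yields rho <= lambda.
   Since var = Z/n - 4m^2/n^2, the right-hand side is exactly Z/(2m) - 2m/n. *)

theory Submission
  imports Defs
begin

text \<open>Weighting |\<mu>| |x_i| \<le> sum_j |a_ij| |x_j| by \<open>w i\<close> and summing over
  i bounds |\<mu>| S by l S, where S = sum_i w_i |x_i|. Weights may vanish, as isolated vertices
  have degree 0; \<open>null\<close> then keeps S positive.\<close>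

lemma eigenvalue_norm_le_weighted_column_sum:
  fixes A :: "complex mat" and w :: "nat \<Rightarrow> real"
  assumes A: "A \<in> carrier_mat n n"
    and ev: "eigenvalue A \<mu>"
    and w: "\<And>i. i < n \<Longrightarrow> w i \<ge> 0"
    and l: "l \<ge> 0"
    and col: "\<And>j. j < n \<Longrightarrow> (\<Sum>i<n. w i * norm (A $$ (i, j))) \<le> l * w j"
    and null: "\<And>i j. i < n \<Longrightarrow> j < n \<Longrightarrow> w i = 0 \<Longrightarrow> A $$ (i, j) = 0"
  shows "norm \<mu> \<le> l"
proof (cases "\<mu> = 0")
  case True
  then show ?thesis using l by simp
next
  case False
  obtain x where x: "x \<in> carrier_vec n" "x \<noteq> 0\<^sub>v n" "A *\<^sub>v x = \<mu> \<cdot>\<^sub>v x"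
    using ev A by (auto simp: eigenvalue_def eigenvector_def)
  have row: "\<mu> * x $ i = (\<Sum>j<n. A $$ (i, j) * x $ j)" if "i < n" for i
  proof -
    have "\<mu> * x $ i = (A *\<^sub>v x) $ i"
      using x that by simp
    also have "\<dots> = (\<Sum>j<n. A $$ (i, j) * x $ j)"
      using x(1) A that by (auto simp: scalar_prod_def lessThan_atLeast0 intro!: sum.cong)
    finally show ?thesis .
  qed
  define S where "S = (\<Sum>i<n. w i * norm (x $ i))"
  obtain k where k: "k < n" "x $ k \<noteq> 0"
    using x(1,2) by (metis carrier_vecD eq_vecI index_zero_vec)
  \<comment> \<open>A zero weight would make row k of \<open>A\<close> vanish, hence \<mu> * x_k =
    0; so every nonzero coordinate of \<open>x\<close> carries positive weight.\<close>
  have "w k \<noteq> 0"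
  proof
    assume "w k = 0"
    then have "\<mu> * x $ k = 0"
      using null k(1) by (simp add: row)
    then show False using False k by simp
  qed
  then have "0 < w k * norm (x $ k)"
    using w[OF k(1)] k(2) by simp
  also have "\<dots> \<le> S"
    unfolding S_def using k(1) w by (intro member_le_sum) auto
  finally have S: "S > 0" .
  have "norm \<mu> * S = (\<Sum>i<n. w i * norm (\<mu> * x $ i))"
    unfolding S_def by (simp add: sum_distrib_left norm_mult mult_ac)
  also have "\<dots> \<le> (\<Sum>i<n. w i * (\<Sum>j<n. norm (A $$ (i, j)) * norm (x $ j)))"
  proof (intro sum_mono mult_left_mono)
    fix i assume "i \<in> {..<n}"
    then show "norm (\<mu> * x $ i) \<le> (\<Sum>j<n. norm (A $$ (i, j)) * norm (x $ j))"
      using norm_sum[of "\<lambda>j. A $$ (i, j) * x $ j" "{..<n}"] by (simp add: row norm_mult)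
  qed (use w in auto)
  \<comment> \<open>Exchanging the sums collects the weighted column sums, to which
    \<open>col\<close> applies.\<close>
  also have "\<dots> = (\<Sum>j<n. (\<Sum>i<n. w i * norm (A $$ (i, j))) * norm (x $ j))"
    unfolding sum_distrib_left sum_distrib_right
    by (subst sum.swap) (simp add: mult_ac)
  also have "\<dots> \<le> (\<Sum>j<n. l * w j * norm (x $ j))"
    using col by (intro sum_mono mult_right_mono) auto
  also have "\<dots> = l * S"
    unfolding S_def by (simp add: sum_distrib_left mult_ac)
  finally show ?thesis using S by simp
qed

lemma sum_list_index:
  assumes "distinct vs"
  shows "(\<Sum>i<length vs. f (vs ! i)) = (\<Sum>v\<in>set vs. f v)"
  using sum.reindex_bij_betw[OF bij_betw_nth[OF assms refl refl]] .

lemma adjacent_commute: "adjacent E u v \<longleftrightarrow> adjacent E v u"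
  by (simp add: adjacent_def insert_commute)

text \<open>The map sending v to {u, v} is a bijection from the neighbours of u to the edges at u;
  it is onto because edges have exactly two elements.\<close>

lemma deg_eq_card_incident:
  assumes "simple_graph V E"
  shows "deg V E u = card {e \<in> E. u \<in> e}"
proof -
  have "bij_betw (\<lambda>v. {u, v}) {v \<in> V. adjacent E u v} {e \<in> E. u \<in> e}"
  proof (rule bij_betwI')
    fix e assume e: "e \<in> {e \<in> E. u \<in> e}"
    then have "card e = 2" "e \<subseteq> V"
      using assms by (auto simp: simple_graph_def)
    then obtain v where "e = {u, v}"
      using e by (auto simp: card_2_iff)
    then show "\<exists>v\<in>{v \<in> V. adjacent E u v}. e = {u, v}"
      using e \<open>e \<subseteq> V\<close> by (auto simp: adjacent_def)
  qed (auto simp: adjacent_def doubleton_eq_iff)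
  then show ?thesis
    unfolding deg_def by (rule bij_betw_same_card)
qed

text \<open>Counts the incident pairs (u, e) in two ways, each edge containing exactly two
  vertices.\<close>

lemma sum_deg:
  assumes "simple_graph V E"
  shows "(\<Sum>u\<in>V. deg V E u) = 2 * card E"
proof -
  have "finite V" "E \<subseteq> Pow V"
    using assms by (auto simp: simple_graph_def)
  moreover from this have "finite E"
    by (meson finite_Pow_iff finite_subset)
  moreover have "card {u \<in> V. u \<in> e} = 2" if "e \<in> E" for e
  proof -
    have "{u \<in> V. u \<in> e} = e" "card e = 2"
      using assms that by (auto simp: simple_graph_def)
    then show ?thesis by simp
  qed
  ultimately show ?thesis
    unfolding deg_eq_card_incident[OF assms] by (intro sum_multicount) auto
qed

lemma harmonic_constant:
  assumes "simple_graph V E"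
    and l: "\<And>u. u \<in> V \<Longrightarrow>
      l * real (deg V E u) = (\<Sum>v | v \<in> V \<and> adjacent E u v. real (deg V E v))"
  shows "l * (2 * real (card E)) = graph_Z V E"
proof -
  have fin: "finite V"
    using assms(1) by (simp add: simple_graph_def)
  have "l * (2 * real (card E)) = (\<Sum>u\<in>V. l * real (deg V E u))"
    using arg_cong[OF sum_deg[OF assms(1)], of real] by (simp add: sum_distrib_left[symmetric])
  also have "\<dots> = (\<Sum>u\<in>V. \<Sum>v | v \<in> V \<and> adjacent E u v. real (deg V E v))"
    using l by (rule sum.cong[OF refl])
  also have "\<dots> = (\<Sum>v\<in>V. \<Sum>u | u \<in> V \<and> adjacent E u v. real (deg V E v))"
    using fin by (rule sum.swap_restrict) (rule fin)
  \<comment> \<open>The summand is constant in u, and by symmetry of adjacency u runs over the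
    neighbours of v, so each inner sum is d_v * d_v.\<close>
  also have "\<dots> = graph_Z V E"
    unfolding graph_Z_def
    by (simp add: deg_def adjacent_commute[of E _ v for v] power2_eq_square)
  finally show ?thesis .
qed

text \<open>With the degrees as weights, symmetry of adjacency turns the weighted sum of column j
  into the sum of the degrees of the neighbours of \<open>vs ! j\<close>, so harmonicity gives
  \<open>col\<close> with equality.\<close>

lemma spectral_radius_le_harmonic_constant:
  assumes vs: "distinct vs" "set vs = V" "vs \<noteq> []"
    and l0: "l \<ge> 0"
    and l: "\<And>u. u \<in> V \<Longrightarrow>
      l * real (deg V E u) = (\<Sum>v | v \<in> V \<and> adjacent E u v. real (deg V E v))"
  shows "spectral_radius (adjacency_matrix vs E) \<le> l"
proof -
  let ?A = "adjacency_matrix vs E" and ?n = "length vs"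
  define w where "w i = real (deg V E (vs ! i))" for i
  have fin: "finite V" using vs by auto
  have A: "?A \<in> carrier_mat ?n ?n"
    by (simp add: adjacency_matrix_def)
  have "(\<Sum>i<?n. w i * norm (?A $$ (i, j))) = l * w j" if "j < ?n" for j
  proof -
    have "(\<Sum>i<?n. w i * norm (?A $$ (i, j)))
        = (\<Sum>i<?n. if adjacent E (vs ! j) (vs ! i) then real (deg V E (vs ! i)) else 0)"
      using that
      by (intro sum.cong) (auto simp: adjacency_matrix_def w_def adjacent_commute)
    also have "\<dots> = (\<Sum>v\<in>V. if adjacent E (vs ! j) v then real (deg V E v) else 0)"
      using sum_list_index[OF vs(1), of "\<lambda>v. if adjacent E (vs ! j) v then real (deg V E v) else 0"]
      by (simp add: vs(2))
    also have "\<dots> = l * w j"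
      using l[of "vs ! j"] that vs(2) fin by (auto simp: w_def sum.inter_filter)
    finally show ?thesis .
  qed
  \<comment> \<open>A vertex of degree 0 has no neighbours, so its row is zero.\<close>
  moreover have "?A $$ (i, j) = 0" if "i < ?n" "j < ?n" "w i = 0" for i j
    using that fin vs(2) by (auto simp: w_def deg_def adjacency_matrix_def)
  ultimately have "norm \<mu> \<le> l" if "eigenvalue ?A \<mu>" for \<mu>
    using eigenvalue_norm_le_weighted_column_sum[OF A that, of w l] l0 by (simp add: w_def)
  \<comment> \<open>A matrix of positive dimension attains its spectral radius as the norm of an
    eigenvalue; \<open>vs \<noteq> []\<close> gives the dimension.\<close>
  then show ?thesis
    using spectral_radius_mem_max(1)[OF A] vs(3) by (auto simp: spectrum_def)
qed

text \<open>Variance is mean square minus squared mean; \<open>sum_deg\<close> identifies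
  \<open>mean_degree\<close> as the average of the degrees.\<close>

lemma graph_var_eq:
  assumes "simple_graph V E" "V \<noteq> {}"
  shows "graph_var V E = graph_Z V E / real (card V) - (mean_degree V E)\<^sup>2"
proof -
  let ?n = "real (card V)" and ?\<mu> = "mean_degree V E" and ?Z = "graph_Z V E"
  have n: "?n > 0"
    using assms by (simp add: simple_graph_def card_gt_0_iff)
  have "(\<Sum>u\<in>V. real (deg V E u)) = ?\<mu> * ?n"
    using arg_cong[OF sum_deg[OF assms(1)], of real] n by (simp add: mean_degree_def)
  moreover have "(\<Sum>u\<in>V. (real (deg V E u) - ?\<mu>)\<^sup>2)
      = ?Z - 2 * ?\<mu> * (\<Sum>u\<in>V. real (deg V E u)) + ?n * ?\<mu>\<^sup>2"
    by (simp add: power2_diff sum.distrib sum_subtractf graph_Z_def sum_distrib_left mult_ac)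
  ultimately have "(\<Sum>u\<in>V. (real (deg V E u) - ?\<mu>)\<^sup>2) = ?Z - ?n * ?\<mu>\<^sup>2"
    by (simp add: power2_eq_square)
  then show ?thesis
    using n by (simp add: graph_var_def field_simps)
qed

theorem theorem2p1:
  fixes V :: "'a set" and E :: "'a set set" and vs :: "'a list" and n m :: nat
  assumes "simple_graph V E"
    and "n = card V" and "m = card E" and "m \<ge> 1"
    and "harmonic_graph V E"
    and "distinct vs" and "set vs = V"
  shows "graph_epsilon vs E
         \<le> sqrt (graph_var V E) * sqrt (real n * graph_Z V E / (4 * (real m)\<^sup>2) - 1)"
proof -
  let ?Z = "graph_Z V E"
  have m: "real m > 0" using assms(4) by simp
  \<comment> \<open>With no vertices the degree sum would be 0, forcing m = 0.\<close>
  have V: "V \<noteq> {}"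
    using sum_deg[OF assms(1)] assms(3,4) by auto
  then have n: "real n > 0"
    using assms(1,2) by (simp add: simple_graph_def card_gt_0_iff)
  obtain l where l: "\<And>u. u \<in> V \<Longrightarrow>
      l * real (deg V E u) = (\<Sum>v | v \<in> V \<and> adjacent E u v. real (deg V E v))"
    using assms(5) by (auto simp: harmonic_graph_def)
  have lZ: "l = ?Z / (2 * real m)"
    using harmonic_constant[OF assms(1) l] m assms(3) by (simp add: field_simps)
  have "?Z \<ge> 0"
    by (simp add: graph_Z_def sum_nonneg)
  then have "l \<ge> 0"
    using lZ m by simp
  then have "spectral_radius (adjacency_matrix vs E) \<le> l"
    using V assms(6,7) l by (intro spectral_radius_le_harmonic_constant) auto
  then have eps: "graph_epsilon vs E \<le> ?Z / (2 * real m) - 2 * real m / real n"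
    using assms(2,3,7) lZ by (simp add: graph_epsilon_def mean_degree_def)
  have var: "graph_var V E = ?Z / real n - (2 * real m / real n)\<^sup>2"
    using graph_var_eq[OF assms(1) V] assms(2,3) by (simp add: mean_degree_def)
  \<comment> \<open>With t = Z/(2m) - 2m/n, the two factors are (2m/n) t and (n/(2m)) t.\<close>
  have "graph_var V E * (real n * ?Z / (4 * (real m)\<^sup>2) - 1)
      = (?Z / (2 * real m) - 2 * real m / real n)\<^sup>2"
    unfolding var using m n by (simp add: field_simps power2_eq_square)
  \<comment> \<open>The right-hand side becomes sqrt (t^2) = |t|, which is at least t whatever its
    sign.\<close>
  then show ?thesis
    using eps by (simp add: real_sqrt_mult[symmetric])
qed

end
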